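(* Let $n>0$ be an integer divisible by $q-1$. Let $m=\frac n{q-1}$ and write $m=p^cm_0$ with $c\ge0$ and $m_0>0$ prime to $p$; let $\ell$ be the least common multiple of the integers $r\ge1$ such that $q^r-1\mid n$; put $\varepsilon_n(t)=(t^{q^\ell}-t)^{p^c}\in\mathbb{F}[t]$. Then $$\varepsilon_n(\theta)\cdot\operatorname{BC}_n\cdot\frac{\Pi(n-1)}{\Pi(n)}\in\mathbb{F}[\theta].$$
   Context: $\mathbb{F}$ is a finite field with $q$ elements and characteristic $p$; $\theta$ is an indeterminate. $D_0=1$ and $D_i=\prod_{j=0}^{i-1}(\theta^{q^i}-\theta^{q^j})$; the Carlitz exponential is $\exp_C(x)=\sum_{i\ge0}x^{q^i}/D_i$. The Carlitz factorial of $n\ge0$ with base $q$ expansion $n=c_0+c_1q+\cdots$ ($0\le c_i<q$) is $\Pi(n)=\prod_iD_i^{c_i}\in\mathbb{F}[\theta]$. The Bernoulli–Carlitz fraction $\operatorname{BC}_n\in\mathbb{F}(\theta)$ is defined by $\frac{x}{\exp_C(x)}=\sum_{n\ge0}\frac{\operatorname{BC}_n}{\Pi(n)}x^n$. *)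

theory Defs
  imports "HOL-Computational_Algebra.Computational_Algebra" "HOL-Library.Cardinality"
begin

text \<open>
  The finite field is a type \<open>'a\<close> of class \<open>{field, finite}\<close>, so \<open>q = CARD('a)\<close> and
  \<open>p = CHAR('a)\<close>. The rings \<open>F[\<theta>]\<close> and \<open>F(\<theta>)\<close> are \<open>'a poly\<close> and \<open>'a poly fract\<close>, with
  \<open>\<theta> = [:0, 1:]\<close>; \<open>F[\<theta>]\<close> sits inside \<open>F(\<theta>)\<close> as \<open>range to_fract\<close>.
\<close>

abbreviation theta :: "'a::{field,finite} poly" where
  "theta \<equiv> [:0, 1:]"

definition carlitz_D :: "nat \<Rightarrow> 'a::{field,finite} poly" where
  "carlitz_D i = (\<Prod>j<i. theta ^ (CARD('a) ^ i) - theta ^ (CARD('a) ^ j))"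

text \<open>The sum below has one term if \<open>n\<close> is a power of \<open>q\<close>, and none otherwise.\<close>

definition carlitz_exp :: "'a::{field,finite} poly fract fps" where
  "carlitz_exp = Abs_fps (\<lambda>n. \<Sum>i | CARD('a) ^ i = n. 1 / to_fract (carlitz_D i))"

text \<open>
  The digit \<open>c\<^sub>i\<close> of \<open>n\<close> in base \<open>q\<close> is \<open>(n div q ^ i) mod q\<close>; it vanishes for \<open>i > n\<close>, so the
  product may stop at \<open>n\<close>.
\<close>

definition carlitz_factorial :: "nat \<Rightarrow> 'a::{field,finite} poly" where
  "carlitz_factorial n = (\<Prod>i\<le>n. carlitz_D i ^ ((n div CARD('a) ^ i) mod CARD('a)))"

text \<open>
  \<open>carlitz_exp\<close> has zero constant term and nonzero linear term, so the quotient below is the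
  honest one: see \<open>bernoulli_carlitz_generating_function\<close>.
\<close>

definition bernoulli_carlitz :: "nat \<Rightarrow> 'a::{field,finite} poly fract" where
  "bernoulli_carlitz n = to_fract (carlitz_factorial n) * fps_nth (fps_X / carlitz_exp) n"

lemma card_field_ge_2: "CARD('a::{field,finite}) \<ge> 2"
proof -
  have "card {0, 1 :: 'a} \<le> CARD('a)"
    by (intro card_mono) auto
  thus ?thesis by simp
qed

lemma carlitz_D_nonzero: "carlitz_D i \<noteq> (0 :: 'a::{field,finite} poly)"
proof -
  have "theta ^ (CARD('a) ^ i) \<noteq> (theta :: 'a poly) ^ (CARD('a) ^ j)" if "j < i" for j
  proof
    assume "theta ^ (CARD('a) ^ i) = (theta :: 'a poly) ^ (CARD('a) ^ j)"
    hence "degree ((theta :: 'a poly) ^ (CARD('a) ^ i)) = degree ((theta :: 'a poly) ^ (CARD('a) ^ j))"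
      by simp
    hence "CARD('a) ^ i = CARD('a) ^ j"
      by (simp add: degree_power_eq)
    thus False
      using that card_field_ge_2[where 'a='a] by (auto dest: power_inject_exp[THEN iffD1, rotated])
  qed
  thus ?thesis by (simp add: carlitz_D_def)
qed

lemma carlitz_factorial_nonzero: "carlitz_factorial n \<noteq> (0 :: 'a::{field,finite} poly)"
  by (simp add: carlitz_factorial_def carlitz_D_nonzero)

lemma carlitz_exp_nth:
  "fps_nth (carlitz_exp :: 'a::{field,finite} poly fract fps) (CARD('a) ^ i)
     = 1 / to_fract (carlitz_D i)"
proof -
  have "{j. CARD('a) ^ j = CARD('a) ^ i} = {i}"
    using card_field_ge_2[where 'a='a] by (auto dest: power_inject_exp[THEN iffD1, rotated])
  thus ?thesis by (simp add: carlitz_exp_def)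
qed

lemma bernoulli_carlitz_generating_function:
  "Abs_fps (\<lambda>n. bernoulli_carlitz n / to_fract (carlitz_factorial n)) * carlitz_exp
     = (fps_X :: 'a::{field,finite} poly fract fps)"
proof -
  let ?e = "carlitz_exp :: 'a poly fract fps"
  have 0: "fps_nth ?e 0 = 0"
    using card_field_ge_2[where 'a='a] by (simp add: carlitz_exp_def)
  have 1: "fps_nth ?e 1 \<noteq> 0"
    using carlitz_exp_nth[of 0, where 'a='a] by (simp add: carlitz_D_def)
  have "subdegree ?e = 1"
    using 0 1 by (intro subdegreeI) auto
  hence "?e dvd fps_X"
    using 1 by (subst fps_dvd_iff) auto
  moreover have "Abs_fps (\<lambda>n. bernoulli_carlitz n / to_fract (carlitz_factorial n)) = fps_X / ?e"
    by (rule fps_ext) (simp add: bernoulli_carlitz_def carlitz_factorial_nonzero)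
  ultimately show ?thesis by simp
qed

end

(*
  Write e for the Carlitz exponential, b = x / e and A = F[theta]. For a in A one has
  e(ax) = e(x) u(x), where u has constant term a and Pi(n) u_n lies in A.
  Since e' = 1, logarithmic differentiation gives (b(ax) - b(x)) u(x) = x u'(x), and the
  series with Pi(n) f_n integral form a ring closed under derivation. Hence
  beta = Pi(n - 1) b_n satisfies: (a^n - 1) beta is integral at every prime P not dividing a.
  Let r = deg P. If q^r - 1 does not divide n, some a has P dividing neither a nor a^n - 1.
  Otherwise P divides theta^(q^l) - theta, and for a = 1 + P the power of P in a^n - 1 is exactly
  p^c. In both cases eps_n(theta) beta is integral at P.
*)
theory Submission
  imports Defs
begin

section \<open>Residues modulo a prime of \<open>F[theta]\<close>\<close>

lemma card_poly_coeff_eq_0: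
  "finite {a :: 'a::{field,finite} poly. \<forall>i\<ge>r. coeff a i = 0} \<and>
   card {a :: 'a poly. \<forall>i\<ge>r. coeff a i = 0} = CARD('a) ^ r"
proof (induction r)
  case 0
  \<comment> \<open>The coefficient condition leaves \<open>{0}\<close>, of size
    \<open>q ^ 0\<close>; the condition \<open>degree a < 0\<close> would give the empty set and
    spoil the start of the induction.\<close>
  have "{a :: 'a poly. \<forall>i\<ge>0. coeff a i = 0} = {0}"
    by (auto simp: poly_eq_iff)
  thus ?case by simp
next
  case (Suc r)
  let ?U = "\<lambda>r. {a :: 'a poly. \<forall>i\<ge>r. coeff a i = 0}"
  have "?U (Suc r) = (\<lambda>(x, a). pCons x a) ` (UNIV \<times> ?U r)"
  proof (intro equalityI subsetI)
    fix a assume a: "a \<in> ?U (Suc r)"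
    obtain x b where ab: "a = pCons x b" by (cases a) auto
    have "coeff b i = 0" if "i \<ge> r" for i
      using a that by (auto simp: ab dest: spec[of _ "Suc i"])
    thus "a \<in> (\<lambda>(x, a). pCons x a) ` (UNIV \<times> ?U r)"
      by (auto simp: ab)
  qed (auto simp: coeff_pCons split: nat.split)
  moreover have "inj_on (\<lambda>(x, a). pCons x a) (UNIV \<times> ?U r)"
    by (auto simp: inj_on_def)
  ultimately show ?case
    using Suc.IH by (simp add: card_image)
qed

lemma
  fixes r :: nat
  assumes "r > 0"
  shows finite_poly_degree_less: "finite {a :: 'a::{field,finite} poly. degree a < r}"
    and card_poly_degree_less: "card {a :: 'a poly. degree a < r} = CARD('a) ^ r"
proof -
  have "{a :: 'a poly. degree a < r} = {a. \<forall>i\<ge>r. coeff a i = 0}"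
    using assms by (auto simp: coeff_eq_0 intro: degree_lessI)
  thus "finite {a :: 'a poly. degree a < r}" "card {a :: 'a poly. degree a < r} = CARD('a) ^ r"
    using card_poly_coeff_eq_0[of r, where 'a='a] by auto
qed

lemma prime_elem_poly_degree_pos: "prime_elem (P :: 'a::field poly) \<Longrightarrow> degree P > 0"
  by (metis gr0I is_unit_iff_degree prime_elem_def)

text \<open>Polynomials of degree below \<open>degree P\<close> represent distinct residue classes
  modulo \<open>P\<close>. With \<open>t = 0\<close>: the nonzero ones are not divisible by
  \<open>P\<close>.\<close>

lemma eq_if_dvd_diff_degree_less:
  fixes P :: "'a::field poly"
  assumes "P dvd s - t" "degree s < degree P" "degree t < degree P"
  shows "s = t"
proof (rule ccontr)
  assume "s \<noteq> t"
  with assms(1) have "degree P \<le> degree (s - t)" by (intro dvd_imp_degree_le) auto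
  moreover have "degree (s - t) < degree P" using assms(2,3) by (rule degree_diff_less)
  ultimately show False by simp
qed

text \<open>Euler's argument: if \<open>P\<close> does not divide \<open>a\<close>, multiplication
  by \<open>a\<close> permutes the \<open>q ^ degree P - 1\<close> nonzero residues, so their
  product changes only by the factor \<open>a ^ (q ^ degree P - 1)\<close>.\<close>

lemma poly_fermat:
  fixes P a :: "'a::{field,finite} poly"
  assumes "prime_elem P"
  shows "P dvd a ^ (CARD('a) ^ degree P) - a"
proof (cases "P dvd a")
  case True
  have "CARD('a) ^ degree P > 0" by simp
  with True have "P dvd a ^ (CARD('a) ^ degree P)" by (meson dvd_power dvd_trans)
  with True show ?thesis by (rule dvd_diff[rotated])
next
  case False
  let ?r = "degree P" and ?S = "{s :: 'a poly. degree s < degree P} - {0}"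
  have r: "?r > 0" using assms by (rule prime_elem_poly_degree_pos)
  have P0: "P \<noteq> 0" using r by auto
  have fin: "finite ?S" using finite_poly_degree_less[OF r] by blast
  have card: "card ?S = CARD('a) ^ ?r - 1"
    using finite_poly_degree_less[OF r, where 'a='a] card_poly_degree_less[OF r, where 'a='a] r
    by (subst card_Diff_singleton) auto
  have ndvd: "\<not> P dvd s" if "s \<in> ?S" for s
    using that eq_if_dvd_diff_degree_less[of P s 0] r by auto
  have inj: "inj_on (\<lambda>s. (a * s) mod P) ?S"
  proof (rule inj_onI)
    fix s t assume st: "s \<in> ?S" "t \<in> ?S" "(a * s) mod P = (a * t) mod P"
    hence "P dvd a * (s - t)" by (simp add: mod_eq_dvd_iff right_diff_distrib)
    hence "P dvd s - t" using False assms by (simp add: prime_elem_dvd_mult_iff)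
    thus "s = t" using st by (intro eq_if_dvd_diff_degree_less) auto
  qed
  have "(\<lambda>s. (a * s) mod P) ` ?S \<subseteq> ?S"
  proof (intro image_subsetI)
    fix s assume s: "s \<in> ?S"
    have "\<not> P dvd a * s" using False assms ndvd[OF s] by (simp add: prime_elem_dvd_mult_iff)
    hence nz: "(a * s) mod P \<noteq> 0" by (simp add: dvd_eq_mod_eq_0)
    with degree_mod_less'[OF P0 nz] show "(a * s) mod P \<in> ?S" by simp
  qed
  \<comment> \<open>An injective map of a finite set into itself is onto.\<close>
  with inj fin have img: "(\<lambda>s. (a * s) mod P) ` ?S = ?S" by (intro endo_inj_surj)
  have "(\<Prod>s\<in>?S. a * s) mod P = (\<Prod>s\<in>?S. (a * s) mod P) mod P"
    by (rule mod_prod_eq[symmetric])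
  also have "(\<Prod>s\<in>?S. (a * s) mod P) = \<Prod>?S"
    using prod.reindex[OF inj, of id] img by simp
  finally have "P dvd (\<Prod>s\<in>?S. a * s) - \<Prod>?S" by (simp add: mod_eq_dvd_iff)
  moreover have "(\<Prod>s\<in>?S. a * s) - \<Prod>?S = (a ^ (CARD('a) ^ ?r - 1) - 1) * \<Prod>?S"
    by (simp add: prod.distrib card algebra_simps)
  \<comment> \<open>The product of the nonzero residues may be cancelled modulo
    \<open>P\<close>.\<close>
  moreover have "\<not> P dvd \<Prod>A" if "finite A" "\<And>s. s \<in> A \<Longrightarrow> \<not> P dvd s" for A
    using that assms
    by (induction A rule: finite_induct) (auto simp: prime_elem_dvd_mult_iff prime_elem_not_unit)
  hence "\<not> P dvd \<Prod>?S" using fin ndvd by blast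
  ultimately have "P dvd a ^ (CARD('a) ^ ?r - 1) - 1"
    using assms by (simp add: prime_elem_dvd_mult_iff)
  hence "P dvd a * (a ^ (CARD('a) ^ ?r - 1) - 1)" by simp
  moreover have "a * a ^ (CARD('a) ^ ?r - 1) = a ^ (CARD('a) ^ ?r)"
    by (simp flip: power_Suc)
  ultimately show ?thesis by (simp add: right_diff_distrib)
qed

text \<open>A nonzero polynomial over the domain \<open>A/P\<close> has no more roots than its
  degree. The quotient ring is avoided: \<open>[:P:] dvd f\<close> says that every coefficient
  vanishes modulo \<open>P\<close>, and the last assumption makes the roots in \<open>S\<close>
  pairwise incongruent.\<close>

lemma poly_roots_mod_prime_bound:
  fixes P :: "'a::idom poly" and f :: "'a poly poly"
  assumes "prime_elem P" and "\<not> [:P:] dvd f"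
  assumes "finite S" and "\<And>s. s \<in> S \<Longrightarrow> P dvd poly f s"
    and "\<And>s t. s \<in> S \<Longrightarrow> t \<in> S \<Longrightarrow> P dvd s - t \<Longrightarrow> s = t"
  shows "card S \<le> degree f"
  using assms(2-)
proof (induction "degree f" arbitrary: f S rule: less_induct)
  case less
  show ?case
  proof (cases "S = {}")
    case False
    then obtain s where s: "s \<in> S" by blast
    define g where "g = synthetic_div f s"
    have f: "f = [:-s, 1:] * g + [:poly f s:]"
      using synthetic_div_correct'[of s f] by (simp add: g_def)
    have "degree f \<noteq> 0"
    proof
      assume "degree f = 0"
      then obtain x where x: "f = [:x:]" by (auto elim: degree_eq_zeroE)
      with less.prems(3)[OF s] less.prems(1) show False by (simp add: const_poly_dvd_const_poly_iff)
    qed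
    have [simp]: "[:P:] dvd [:poly f s:]"
      using less.prems(3)[OF s] by (simp add: const_poly_dvd_const_poly_iff)
    have deg: "degree g = degree f - 1" by (simp add: g_def degree_synthetic_div)
    have "card (S - {s}) \<le> degree g"
    proof (rule less.hyps)
      show "degree g < degree f" using deg \<open>degree f \<noteq> 0\<close> by simp
      show "\<not> [:P:] dvd g" using less.prems(1) f by (metis dvd_add dvd_mult \<open>[:P:] dvd [:poly f s:]\<close>)
      show "finite (S - {s})" using less.prems(2) by simp
      fix t assume t: "t \<in> S - {s}"
      \<comment> \<open>Modulo \<open>P\<close>, a root \<open>t\<close> of
        \<open>f = (X - s) g + f(s)\<close> other than \<open>s\<close> is a root of
        \<open>g\<close>.\<close>
      have "P dvd poly f t - poly f s" using less.prems(3) s t by auto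
      moreover have "poly f t - poly f s = (t - s) * poly g t"
        by (subst f) (simp add: algebra_simps)
      moreover have "\<not> P dvd t - s" using less.prems(4)[of t s] s t by auto
      ultimately show "P dvd poly g t" using assms(1) by (simp add: prime_elem_dvd_mult_iff)
    qed (use less.prems(4) in auto)
    thus ?thesis using deg \<open>degree f \<noteq> 0\<close> s less.prems(2) by simp
  qed simp
qed

text \<open>If every nonzero residue satisfied \<open>a ^ n = 1\<close>, Fermat would allow reducing
  \<open>n\<close> to \<open>k = n mod N\<close>, and \<open>X ^ k - 1\<close> with
  \<open>0 < k < N\<close> would have \<open>N\<close> roots modulo \<open>P\<close>.\<close>

lemma ex_poly_power_not_cong_1:
  fixes P :: "'a::{field,finite} poly"
  assumes "prime_elem P" and "\<not> (CARD('a) ^ degree P - 1) dvd n"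
  shows "\<exists>a. \<not> P dvd a \<and> \<not> P dvd a ^ n - 1"
proof (rule ccontr)
  assume "\<not> ?thesis"
  hence *: "P dvd a ^ n - 1" if "\<not> P dvd a" for a using that by blast
  define N where "N = CARD('a) ^ degree P - 1"
  define k where "k = n mod N"
  have r: "degree P > 0" using assms(1) by (rule prime_elem_poly_degree_pos)
  have "CARD('a) ^ 1 \<le> CARD('a) ^ degree P"
    using r by (intro power_increasing) auto
  hence "CARD('a) ^ degree P \<ge> 2"
    using card_field_ge_2[where 'a='a] by simp
  hence N: "N > 0" "CARD('a) ^ degree P = Suc N" by (auto simp: N_def)
  have "n mod N \<noteq> 0" using assms(2) by (simp add: N_def mod_eq_0_iff_dvd)
  hence k: "k > 0" "k < N" using N(1) by (simp_all add: k_def)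
  let ?S = "{s :: 'a poly. degree s < degree P} - {0}"
  have ndvd: "\<not> P dvd s" if "s \<in> ?S" for s
    using that eq_if_dvd_diff_degree_less[of P s 0] r by auto
  have "card ?S \<le> degree (monom 1 k - 1 :: 'a poly poly)"
  proof (rule poly_roots_mod_prime_bound[OF assms(1)])
    show "\<not> [:P:] dvd monom 1 k - 1"
    proof
      assume "[:P:] dvd monom 1 k - 1"
      hence "P dvd coeff (monom 1 k - 1) k" by (simp only: const_poly_dvd_iff)
      with k(1) show False using assms(1) by (auto simp: prime_elem_def)
    qed
    show "finite ?S" using finite_poly_degree_less[OF r] by blast
    show "s = t" if "s \<in> ?S" "t \<in> ?S" "P dvd s - t" for s t
      using that by (intro eq_if_dvd_diff_degree_less) auto
    fix s assume s: "s \<in> ?S"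
    note nd = ndvd[OF s]
    have "P dvd s * (s ^ N - 1)"
      using poly_fermat[OF assms(1), of s] by (simp add: N(2) algebra_simps)
    hence "s ^ N mod P = 1 mod P"
      using assms(1) nd by (simp add: prime_elem_dvd_mult_iff mod_eq_dvd_iff)
    hence "(s ^ N) ^ (n div N) mod P = 1 mod P"
      by (metis power_mod power_one)
    moreover have "s ^ n = (s ^ N) ^ (n div N) * s ^ k"
      by (simp add: k_def flip: power_mult power_add)
    ultimately have "s ^ n mod P = s ^ k mod P"
      by (metis mod_mult_left_eq mult_1)
    moreover have "s ^ n mod P = 1 mod P" using *[OF nd] by (simp add: mod_eq_dvd_iff)
    ultimately have "s ^ k mod P = 1 mod P" by metis
    hence "P dvd s ^ k - 1" by (simp add: mod_eq_dvd_iff)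
    thus "P dvd poly (monom 1 k - 1) s" by (simp add: poly_monom)
  qed
  moreover have "degree (monom 1 k - 1 :: 'a poly poly) \<le> k"
    by (intro degree_diff_le) (auto simp: degree_monom_eq)
  moreover have "card ?S = N"
    using finite_poly_degree_less[OF r, where 'a='a] card_poly_degree_less[OF r, where 'a='a] r
    by (subst card_Diff_singleton) (auto simp: N_def)
  ultimately show False using k by simp
qed

section \<open>The \<open>q\<close>-th power map in characteristic \<open>p\<close>\<close>

lemma finite_field_power_card:
  fixes x :: "'a::{field,finite}"
  shows "x ^ CARD('a) = x"
proof -
  \<comment> \<open>Fermat's congruence for the prime \<open>theta\<close>, of degree 1, and the
    constant \<open>x\<close>; a constant divisible by \<open>theta\<close> vanishes.\<close>
  have "[:0, 1:] dvd [:x ^ CARD('a) - x:]"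
    using poly_fermat[of "[:0, 1:]" "[:x:]"]
    by (simp add: prime_elem_linear_field_poly poly_const_pow)
  hence "poly [:x ^ CARD('a) - x:] 0 = 0" by (metis dvd_iff_poly_eq_0 minus_zero)
  thus ?thesis by simp
qed

lemma CHAR_prime_finite_field: "prime CHAR('a::{field,finite})"
  using finite_imp_CHAR_pos[where 'a='a] by (intro prime_CHAR_semidom) auto

text \<open>The inner terms of \<open>(X + 1) ^ q\<close> form a polynomial of degree below
  \<open>q\<close> that vanishes at all \<open>q\<close> elements of the field, since
  \<open>x ^ q = x\<close> there. So its coefficients are zero in the field.\<close>

lemma CHAR_dvd_card_choose:
  assumes "0 < k" "k < CARD('a::{field,finite})"
  shows "CHAR('a) dvd (CARD('a) choose k)"
proof -
  define f :: "'a poly" where "f = (\<Sum>k\<in>{0<..<CARD('a)}. monom (of_nat (CARD('a) choose k)) k)"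
  have card: "CARD('a) > 0" by simp
  have "poly f x = 0" for x
  proof -
    have "{..CARD('a)} = insert 0 (insert CARD('a) {0<..<CARD('a)})" using card by auto
    hence "(x + 1) ^ CARD('a) = 1 + (x ^ CARD('a) + poly f x)"
      using card by (subst binomial_ring) (simp add: f_def poly_sum poly_monom)
    thus ?thesis by (simp add: finite_field_power_card)
  qed
  moreover have "degree f < CARD('a)"
    unfolding f_def using card
    by (intro degree_sum_less) (auto intro: le_less_trans[OF degree_monom_le])
  ultimately have "f = 0"
    using card_poly_roots_bound[of f] by fastforce
  moreover have "coeff f k = of_nat (CARD('a) choose k)"
    using assms by (simp add: f_def coeff_sum)
  ultimately show ?thesis by (simp add: of_nat_eq_0_iff_char_dvd)
qed

lemma CHAR_dvd_card: "CHAR('a::{field,finite}) dvd CARD('a)"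
  using CHAR_dvd_card_choose[of 1, where 'a='a] card_field_ge_2[where 'a='a] by simp

text \<open>The ring \<open>'b\<close> is separate from the field \<open>'a\<close> because the
  identity serves both \<open>F[theta]\<close> and power series over
  \<open>F(theta)\<close>.\<close>

lemma freshmans_dream_card:
  fixes x y :: "'b::comm_semiring_1"
  assumes "CHAR('b) = CHAR('a::{field,finite})"
  shows "(x + y) ^ CARD('a) = x ^ CARD('a) + y ^ CARD('a)"
proof -
  have card: "CARD('a) > 0" by simp
  have "(x + y) ^ CARD('a) = (\<Sum>k\<le>CARD('a). of_nat (CARD('a) choose k) * x ^ k * y ^ (CARD('a) - k))"
    by (rule binomial_ring)
  also have "\<dots> = (\<Sum>k\<in>{0, CARD('a)}. of_nat (CARD('a) choose k) * x ^ k * y ^ (CARD('a) - k))"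
  proof (intro sum.mono_neutral_right ballI)
    fix k assume "k \<in> {..CARD('a)} - {0, CARD('a)}"
    hence "CHAR('b) dvd (CARD('a) choose k)"
      unfolding assms by (intro CHAR_dvd_card_choose) auto
    hence "of_nat (CARD('a) choose k) = (0 :: 'b)" by (simp add: of_nat_eq_0_iff_char_dvd)
    thus "of_nat (CARD('a) choose k) * x ^ k * y ^ (CARD('a) - k) = 0" by simp
  qed auto
  finally show ?thesis using card by (simp add: add_ac)
qed

lemma freshmans_dream_card_power:
  fixes x y :: "'b::comm_semiring_1"
  assumes "CHAR('b) = CHAR('a::{field,finite})"
  shows "(x + y) ^ (CARD('a) ^ i) = x ^ (CARD('a) ^ i) + y ^ (CARD('a) ^ i)"
proof (induction i)
  case (Suc i)
  have "(x + y) ^ (CARD('a) ^ Suc i) = ((x + y) ^ (CARD('a) ^ i)) ^ CARD('a)"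
    by (simp add: mult.commute flip: power_mult)
  thus ?case
    by (simp add: Suc.IH freshmans_dream_card[OF assms] mult.commute flip: power_mult)
qed simp

lemma freshmans_dream_card_diff:
  fixes x y :: "'b::comm_ring_1"
  assumes "CHAR('b) = CHAR('a::{field,finite})"
  shows "(x - y) ^ CARD('a) = x ^ CARD('a) - y ^ CARD('a)"
  using freshmans_dream_card[OF assms, of "x - y" y] by simp

text \<open>Fermat's congruence applied to \<open>theta ^ (q ^ (r k))\<close>, with
  \<open>r = degree P\<close>, passes from \<open>k\<close> to \<open>k + 1\<close>; the differences
  telescope.\<close>

lemma prime_elem_dvd_theta_power:
  fixes P :: "'a::{field,finite} poly"
  assumes "prime_elem P" "degree P dvd l"
  shows "P dvd theta ^ (CARD('a) ^ l) - theta"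
proof -
  obtain k where l: "l = degree P * k" using assms(2) by blast
  have "P dvd theta ^ (CARD('a) ^ (degree P * k)) - theta"
  proof (induction k)
    case (Suc k)
    let ?t = "theta ^ (CARD('a) ^ (degree P * k)) :: 'a poly"
    have eq: "theta ^ (CARD('a) ^ (degree P * Suc k)) = ?t ^ (CARD('a) ^ degree P)"
      by (simp add: power_add mult.commute flip: power_mult)
    show ?case
      using dvd_add[OF poly_fermat[OF assms(1), of ?t] Suc.IH] unfolding eq
      by (simp only: add_diff_eq diff_add_cancel)
  qed simp
  thus ?thesis by (simp add: l)
qed

lemma CHAR_fract [simp]: "CHAR('a::idom fract) = CHAR('a)"
proof (rule CHAR_eqI)
  have of_nat: "of_nat n = (to_fract (of_nat n) :: 'a fract)" for n
    by (induction n) simp_all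
  show "of_nat CHAR('a) = (0 :: 'a fract)" by (simp add: of_nat)
  show "CHAR('a) dvd n" if "of_nat n = (0 :: 'a fract)" for n
    using that by (simp add: of_nat of_nat_eq_0_iff_char_dvd)
qed

lemma to_fract_power [simp]: "to_fract (x ^ n) = to_fract x ^ n"
  by (induction n) simp_all

section \<open>Divisibility of Carlitz factorials\<close>

lemma carlitz_D_0 [simp]: "carlitz_D 0 = 1"
  by (simp add: carlitz_D_def)

text \<open>The \<open>q\<close>-th power turns the factor of \<open>D_i\<close> with index
  \<open>j\<close> into the factor of \<open>D_(i+1)\<close> with index \<open>j + 1\<close>; only
  the factor with index 0 is left over.\<close>

lemma carlitz_D_Suc:
  "carlitz_D (Suc i) = (theta ^ (CARD('a) ^ Suc i) - theta) * (carlitz_D i :: 'a::{field,finite} poly) ^ CARD('a)"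
proof -
  have "(carlitz_D i :: 'a poly) ^ CARD('a)
      = (\<Prod>j<i. theta ^ (CARD('a) ^ Suc i) - theta ^ (CARD('a) ^ Suc j))"
    unfolding carlitz_D_def prod_power_distrib
    by (intro prod.cong refl, subst freshmans_dream_card_diff)
       (simp_all add: mult.commute flip: power_mult)
  thus ?thesis
    by (simp add: carlitz_D_def prod.lessThan_Suc_shift del: power_Suc prod.lessThan_Suc)
qed

text \<open>
  Splitting off the last digit of \<open>n\<close> moves every other digit to the next \<open>D\<^sub>i\<close>, so the
  induction on \<open>n\<close> needs the offset \<open>s\<close>.
\<close>

definition shifted_carlitz_factorial :: "nat \<Rightarrow> nat \<Rightarrow> 'a::{field,finite} poly" where
  "shifted_carlitz_factorial s n =
     (\<Prod>i\<le>n. carlitz_D (s + i) ^ ((n div CARD('a) ^ i) mod CARD('a)))"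

lemma carlitz_factorial_eq_shifted: "carlitz_factorial n = shifted_carlitz_factorial 0 n"
  by (simp add: carlitz_factorial_def shifted_carlitz_factorial_def)

lemma less_card_power: "n < CARD('a::{field,finite}) ^ n"
  using card_field_ge_2[where 'a='a] by (intro less_le_trans[OF less_exp]) (rule power_mono, auto)

text \<open>Digits beyond position \<open>n\<close> vanish. Enlarging the range lets the products
  for \<open>n\<close> and for \<open>n div q\<close> be matched factor by factor.\<close>

lemma shifted_carlitz_factorial_extend:
  assumes "n \<le> N"
  shows "shifted_carlitz_factorial s n =
     (\<Prod>i\<le>N. carlitz_D (s + i) ^ ((n div CARD('a) ^ i) mod CARD('a)) :: 'a::{field,finite} poly)"
  unfolding shifted_carlitz_factorial_def
proof (intro prod.mono_neutral_left ballI)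
  fix i assume "i \<in> {..N} - {..n}"
  hence "n < CARD('a) ^ i"
    using less_trans[OF _ less_card_power[of i, where 'a='a]] by simp
  thus "carlitz_D (s + i) ^ (n div CARD('a) ^ i mod CARD('a)) = (1 :: 'a poly)" by simp
qed (use assms in auto)

lemma shifted_carlitz_factorial_rec:
  "shifted_carlitz_factorial s n = (carlitz_D s ^ (n mod CARD('a))
     * shifted_carlitz_factorial (Suc s) (n div CARD('a)) :: 'a::{field,finite} poly)"
proof -
  have "shifted_carlitz_factorial s n =
     (\<Prod>i\<le>Suc n. carlitz_D (s + i) ^ ((n div CARD('a) ^ i) mod CARD('a)) :: 'a poly)"
    by (rule shifted_carlitz_factorial_extend) simp
  also have "\<dots> = carlitz_D s ^ (n mod CARD('a)) *
     (\<Prod>i\<le>n. carlitz_D (Suc s + i) ^ ((n div CARD('a) div CARD('a) ^ i) mod CARD('a)))"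
    by (simp add: prod.atMost_Suc_shift div_mult2_eq del: prod.atMost_Suc)
  also have "(\<Prod>i\<le>n. carlitz_D (Suc s + i) ^ ((n div CARD('a) div CARD('a) ^ i) mod CARD('a)))
      = (shifted_carlitz_factorial (Suc s) (n div CARD('a)) :: 'a poly)"
    by (rule shifted_carlitz_factorial_extend[symmetric]) simp
  finally show ?thesis .
qed

lemma shifted_carlitz_factorial_0 [simp]: "shifted_carlitz_factorial s 0 = 1"
  by (simp add: shifted_carlitz_factorial_def)

lemma shifted_carlitz_factorial_card_power:
  "shifted_carlitz_factorial s (CARD('a) ^ i) = (carlitz_D (s + i) :: 'a::{field,finite} poly)"
proof (induction i arbitrary: s)
  case 0
  have "CARD('a) \<ge> 2" by (rule card_field_ge_2)
  thus ?case by (subst shifted_carlitz_factorial_rec) simp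
next
  case (Suc i)
  show ?case by (subst shifted_carlitz_factorial_rec) (simp add: Suc.IH)
qed

text \<open>Addition in base \<open>q\<close>. Without a carry from the last digits, the powers of
  \<open>D_s\<close> agree and induction treats the quotients. A carry trades \<open>D_s ^ q\<close>
  for one more \<open>D_(s+1)\<close>, which is a multiple of it.\<close>

lemma shifted_carlitz_factorial_mult_dvd:
  "shifted_carlitz_factorial s i * shifted_carlitz_factorial s j dvd
     (shifted_carlitz_factorial s (i + j) :: 'a::{field,finite} poly)"
proof (induction "i + j" arbitrary: i j s rule: less_induct)
  case less
  let ?q = "CARD('a)" and ?F = "shifted_carlitz_factorial :: nat \<Rightarrow> nat \<Rightarrow> 'a poly"
  have q: "?q \<ge> 2" by (rule card_field_ge_2)
  show ?case
  proof (cases "i + j = 0")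
    case False
    have ij: "i = ?q * (i div ?q) + i mod ?q" "j = ?q * (j div ?q) + j mod ?q" by simp_all
    have lhs: "?F s i * ?F s j = carlitz_D s ^ (i mod ?q + j mod ?q) *
        (?F (Suc s) (i div ?q) * ?F (Suc s) (j div ?q))"
      by (subst (1 2) shifted_carlitz_factorial_rec) (simp add: power_add mult_ac)
    have rhs: "?F s (i + j) = carlitz_D s ^ ((i + j) mod ?q) * ?F (Suc s) ((i + j) div ?q)"
      by (rule shifted_carlitz_factorial_rec)
    show ?thesis
    proof (cases "i mod ?q + j mod ?q < ?q")
      case True
      hence "(i + j) mod ?q = i mod ?q + j mod ?q"
        by (metis mod_add_eq mod_less)
      moreover from this have "(i + j) div ?q = i div ?q + j div ?q"
        using True by (subst div_add1_eq) simp
      moreover have "i div ?q + j div ?q < i + j"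
      proof (cases "i = 0")
        case True
        thus ?thesis using False q by (simp add: div_less_dividend)
      next
        case False
        have "i div ?q < i" using False q by (simp add: div_less_dividend)
        moreover have "j div ?q \<le> j" by (rule div_le_dividend)
        ultimately show ?thesis by (rule add_less_le_mono)
      qed
      ultimately show ?thesis unfolding lhs rhs using less.hyps by (simp add: mult_dvd_mono)
    next
      case carry: False
      define i' j' where "i' = i div ?q" and "j' = j div ?q"
      have "i mod ?q + j mod ?q < ?q + ?q" by (intro add_strict_mono) simp_all
      with carry have div1: "(i mod ?q + j mod ?q) div ?q = 1"
        by (intro div_nat_eqI) simp_all
      hence div: "(i + j) div ?q = i' + j' + 1"
        by (subst div_add1_eq) (simp add: i'_def j'_def)
      have mod: "i mod ?q + j mod ?q = ?q + (i + j) mod ?q"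
        using div1 by (metis div_mult_mod_eq mod_add_eq mult_1)
      \<comment> \<open>This makes the induction hypothesis available both for
        \<open>i' + j'\<close> and for adding the carry to that sum.\<close>
      have "2 * (i' + j' + 1) \<le> ?q * (i' + j' + 1)" using q by (intro mult_right_mono) auto
      also have "\<dots> \<le> i + j"
        unfolding div[symmetric] by simp
      finally have less': "i' + j' + 1 < i + j" by simp
      have "?F (Suc s) i' * ?F (Suc s) j' dvd ?F (Suc s) (i' + j')"
        using less' by (intro less.hyps) auto
      \<comment> \<open>The carry is a separate summand 1, whose shifted factorial is
        \<open>D_(s+1)\<close>.\<close>
      moreover have "?F (Suc s) (i' + j') * ?F (Suc s) 1 dvd ?F (Suc s) (i' + j' + 1)"
        using less' by (intro less.hyps) auto
      moreover have "?F (Suc s) 1 = carlitz_D (Suc s)"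
        using shifted_carlitz_factorial_card_power[of "Suc s" 0, where 'a='a] by simp
      moreover have "carlitz_D s ^ ?q dvd (carlitz_D (Suc s) :: 'a poly)"
        by (simp add: carlitz_D_Suc)
      ultimately have "carlitz_D s ^ ?q * (?F (Suc s) i' * ?F (Suc s) j') dvd ?F (Suc s) (i' + j' + 1)"
        by (metis (no_types, lifting) dvd_trans mult.commute mult_dvd_mono)
      hence "carlitz_D s ^ ((i + j) mod ?q) * (carlitz_D s ^ ?q * (?F (Suc s) i' * ?F (Suc s) j')) dvd
             carlitz_D s ^ ((i + j) mod ?q) * ?F (Suc s) (i' + j' + 1)"
        by (intro mult_dvd_mono dvd_refl)
      thus ?thesis unfolding lhs rhs div mod by (simp add: power_add mult_ac i'_def j'_def)
    qed
  qed simp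
qed

lemma carlitz_factorial_mult_dvd:
  "carlitz_factorial i * carlitz_factorial j dvd (carlitz_factorial (i + j) :: 'a::{field,finite} poly)"
  unfolding carlitz_factorial_eq_shifted by (rule shifted_carlitz_factorial_mult_dvd)

lemma carlitz_factorial_card_power:
  "carlitz_factorial (CARD('a) ^ i) = (carlitz_D i :: 'a::{field,finite} poly)"
  by (simp add: carlitz_factorial_eq_shifted shifted_carlitz_factorial_card_power)

lemma carlitz_factorial_0 [simp]: "carlitz_factorial 0 = 1"
  by (simp add: carlitz_factorial_eq_shifted)

text \<open>Only the last digit changes, and it belongs to \<open>D_0 = 1\<close>. This is what will
  make differentiation compatible with the factorials.\<close>

lemma carlitz_factorial_Suc_eq:
  assumes "\<not> CARD('a) dvd Suc n"
  shows "carlitz_factorial (Suc n) = (carlitz_factorial n :: 'a::{field,finite} poly)"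
proof -
  have "Suc n div CARD('a) = n div CARD('a)"
    using assms by (simp add: div_Suc dvd_eq_mod_eq_0)
  thus ?thesis
    unfolding carlitz_factorial_eq_shifted by (subst (1 2) shifted_carlitz_factorial_rec) simp
qed

section \<open>The functional equation of the Carlitz exponential\<close>

lemma fps_power_card_nth:
  fixes f :: "'b::comm_ring_1 fps"
  assumes "CHAR('b) = CHAR('a::{field,finite})"
  shows "fps_nth (f ^ CARD('a)) n = (if CARD('a) dvd n then fps_nth f (n div CARD('a)) ^ CARD('a) else 0)"
proof (induction n arbitrary: f rule: less_induct)
  case (less n)
  have q: "CARD('a) > 0" by simp
  \<comment> \<open>Frobenius is applied to this sum of two terms only; the remaining coefficients
    come by induction from the shifted series.\<close>
  have "f = fps_const (fps_nth f 0) + fps_X * fps_shift 1 f"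
    by (rule fps_ext) (auto simp: fps_X_mult_nth)
  hence "f ^ CARD('a) = fps_const (fps_nth f 0 ^ CARD('a)) + fps_X ^ CARD('a) * fps_shift 1 f ^ CARD('a)"
    using freshmans_dream_card[where 'a='a and 'b="'b fps"] assms
    by (metis fps_const_power power_mult_distrib semiring_char_fps)
  hence *: "fps_nth (f ^ CARD('a)) n = (if n = 0 then fps_nth f 0 ^ CARD('a) else 0) +
      (if n < CARD('a) then 0 else fps_nth (fps_shift 1 f ^ CARD('a)) (n - CARD('a)))"
    by (simp add: fps_X_power_mult_nth)
  show ?case
  proof (cases "n < CARD('a)")
    case True
    thus ?thesis unfolding * by (auto dest: dvd_imp_le)
  next
    case False
    have "fps_nth (fps_shift 1 f ^ CARD('a)) (n - CARD('a)) = (if CARD('a) dvd n - CARD('a) then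
        fps_nth (fps_shift 1 f) ((n - CARD('a)) div CARD('a)) ^ CARD('a) else 0)"
      using False q by (intro less.IH) linarith
    moreover have "n div CARD('a) = Suc ((n - CARD('a)) div CARD('a))"
      using False q by (simp add: le_div_geq)
    ultimately show ?thesis
      unfolding * using False q by (auto simp: dvd_minus_self)
  qed
qed

lemma carlitz_exp_nth_eq_0:
  assumes "n \<notin> range (\<lambda>i. CARD('a) ^ i)"
  shows "fps_nth (carlitz_exp :: 'a::{field,finite} poly fract fps) n = 0"
proof -
  have "{i. CARD('a) ^ i = n} = {}" using assms by auto
  thus ?thesis by (simp add: carlitz_exp_def)
qed

lemma carlitz_exp_nth_0 [simp]: "fps_nth (carlitz_exp :: 'a::{field,finite} poly fract fps) 0 = 0"
  by (rule carlitz_exp_nth_eq_0) auto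

lemma carlitz_exp_nth_1 [simp]: "fps_nth (carlitz_exp :: 'a::{field,finite} poly fract fps) (Suc 0) = 1"
  using carlitz_exp_nth[of 0, where 'a='a] by simp

text \<open>The substitution \<open>f(c X)\<close>.\<close>

definition fps_scale :: "'a::comm_ring_1 \<Rightarrow> 'a fps \<Rightarrow> 'a fps" where
  "fps_scale c f = Abs_fps (\<lambda>n. c ^ n * fps_nth f n)"

lemma fps_scale_nth [simp]: "fps_nth (fps_scale c f) n = c ^ n * fps_nth f n"
  by (simp add: fps_scale_def)

lemma fps_scale_mult: "fps_scale c (f * g) = fps_scale c f * fps_scale c g"
proof (rule fps_ext)
  fix n
  have "c ^ n * (fps_nth f i * fps_nth g (n - i)) = (c ^ i * fps_nth f i) * (c ^ (n - i) * fps_nth g (n - i))"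
    if "i \<in> {0..n}" for i
  proof -
    have "c ^ n = c ^ i * c ^ (n - i)" using that by (simp flip: power_add)
    thus ?thesis by (simp add: mult_ac)
  qed
  thus "fps_nth (fps_scale c (f * g)) n = fps_nth (fps_scale c f * fps_scale c g) n"
    unfolding fps_mult_nth sum_distrib_left fps_scale_nth by (rule sum.cong[OF refl])
qed

text \<open>One Horner step from \<open>a\<close> to \<open>x + theta a\<close>:
  \<open>F\<close>-linearity of \<open>e\<close> combined with the Carlitz module equation
  \<open>e(theta X) = theta e(X) + e(X) ^ q\<close>. On coefficients this is the recursion for
  \<open>D_i\<close>.\<close>

lemma fps_scale_carlitz_exp_pCons:
  fixes a :: "'a::{field,finite} poly"
  shows "fps_scale (to_fract (pCons x a)) carlitz_exp =
     fps_const (to_fract [:x:]) * carlitz_exp + fps_const (to_fract theta) * fps_scale (to_fract a) carlitz_exp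
       + fps_scale (to_fract a) carlitz_exp ^ CARD('a)" (is "?l = ?r")
proof (rule fps_ext)
  fix n
  have q: "CARD('a) \<ge> 2" by (rule card_field_ge_2)
  have pw: "fps_nth (fps_scale (to_fract a) carlitz_exp ^ CARD('a)) n =
      (if CARD('a) dvd n then fps_nth (fps_scale (to_fract a) carlitz_exp) (n div CARD('a)) ^ CARD('a) else 0)"
    by (rule fps_power_card_nth) simp
  have pC: "pCons x a = [:x:] + theta * a" by simp
  show "fps_nth ?l n = fps_nth ?r n"
  proof (cases "n \<in> range (\<lambda>i. CARD('a) ^ i)")
    case False
    have "n div CARD('a) \<notin> range (\<lambda>i. CARD('a) ^ i)" if "CARD('a) dvd n"
    proof
      assume "n div CARD('a) \<in> range (\<lambda>i. CARD('a) ^ i)"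
      then obtain i where "n div CARD('a) = CARD('a) ^ i" by blast
      hence "n = CARD('a) ^ Suc i" using that by (metis dvd_mult_div_cancel power_Suc)
      with False show False by blast
    qed
    thus ?thesis using False by (simp add: pw carlitz_exp_nth_eq_0)
  next
    case True
    then obtain i where n: "n = CARD('a) ^ i" by blast
    show ?thesis
    proof (cases i)
      case 0
      \<comment> \<open>The \<open>q\<close>-th power contributes nothing in degree 1.\<close>
      have "\<not> CARD('a) dvd n" using q by (simp add: n 0)
      hence "fps_nth (fps_scale (to_fract a) carlitz_exp ^ CARD('a)) n = 0" by (simp add: pw)
      hence "fps_nth ?r n = to_fract [:x:] + to_fract theta * to_fract a"
        unfolding fps_add_nth by (simp add: n 0)
      thus ?thesis by (simp add: n 0 pC del: mult_pCons_left flip: to_fract_mult to_fract_add)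
    next
      case (Suc j)
      have xq: "x ^ (CARD('a) ^ k) = x" for k
        by (induction k) (simp_all add: power_mult finite_field_power_card)
      have "to_fract (pCons x a) ^ n = to_fract (pCons x a ^ n)" by simp
      also have "pCons x a ^ n = [:x:] ^ n + theta ^ n * a ^ n"
        unfolding pC n power_mult_distrib[symmetric] by (rule freshmans_dream_card_power) simp
      also have "[:x:] ^ n = [:x:]" by (simp add: n poly_const_pow xq)
      finally have 1: "to_fract (pCons x a) ^ n =
          to_fract [:x:] + to_fract theta ^ n * to_fract a ^ n" by simp
      have 2: "fps_nth (fps_scale (to_fract a) carlitz_exp ^ CARD('a)) n =
         to_fract a ^ n / to_fract (carlitz_D j) ^ CARD('a)"
        unfolding pw using q
        by (simp add: n Suc carlitz_exp_nth power_mult_distrib power_divide mult.commute flip: power_mult)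
      have 3: "fps_nth carlitz_exp n = 1 / to_fract (carlitz_D i :: 'a poly)"
        unfolding n by (rule carlitz_exp_nth)
      have 4: "to_fract (carlitz_D i :: 'a poly) =
         (to_fract theta ^ n - to_fract theta) * to_fract (carlitz_D j) ^ CARD('a)"
        by (simp add: n Suc carlitz_D_Suc)
      have nz: "to_fract (carlitz_D i :: 'a poly) \<noteq> 0" "to_fract (carlitz_D j :: 'a poly) \<noteq> 0"
        by (simp_all add: carlitz_D_nonzero)
      \<comment> \<open>Over the common denominator \<open>D_i\<close>, the term
        \<open>theta a ^ n\<close> and this one add up to \<open>theta ^ n a ^ n\<close>.\<close>
      have 5: "to_fract a ^ n / to_fract (carlitz_D j) ^ CARD('a) =
         (to_fract theta ^ n - to_fract theta) * to_fract a ^ n / to_fract (carlitz_D i :: 'a poly)"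
        using nz 4 by (simp add: divide_simps)
      show ?thesis
        by (simp add: 1 2 3 5 del: to_fract_power) (use nz in \<open>simp add: field_simps\<close>)
    qed
  qed
qed

section \<open>Carlitz analogue of Hurwitz series, over a ring between \<open>F[theta]\<close> and
  \<open>F(theta)\<close>\<close>

locale fract_overring =
  fixes R :: "'a::{field,finite} poly fract set"
  assumes to_fract_mem: "\<And>x. to_fract x \<in> R"
    and add_mem: "\<And>x y. x \<in> R \<Longrightarrow> y \<in> R \<Longrightarrow> x + y \<in> R"
    and mult_mem: "\<And>x y. x \<in> R \<Longrightarrow> y \<in> R \<Longrightarrow> x * y \<in> R"
begin

lemma diff_mem: "x \<in> R \<Longrightarrow> y \<in> R \<Longrightarrow> x - y \<in> R"
  using add_mem[of x "to_fract (-1) * y"] mult_mem[of "to_fract (-1)" y] to_fract_mem[of "-1"]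
  by simp

lemma sum_mem: "(\<And>i. i \<in> I \<Longrightarrow> f i \<in> R) \<Longrightarrow> sum f I \<in> R"
  using to_fract_mem[of 0] by (induction I rule: infinite_finite_induct) (auto intro: add_mem)

text \<open>Hurwitz series have \<open>n! f_n\<close> integral; here the Carlitz factorial replaces
  \<open>n!\<close>, and \<open>R\<close> replaces the integers.\<close>

definition carlitz_hurwitz :: "'a poly fract fps set" where
  "carlitz_hurwitz = {f. \<forall>n. to_fract (carlitz_factorial n) * fps_nth f n \<in> R}"

lemma carlitz_hurwitz_D:
  "f \<in> carlitz_hurwitz \<Longrightarrow> to_fract (carlitz_factorial n) * fps_nth f n \<in> R"
  by (simp add: carlitz_hurwitz_def)

lemma carlitz_hurwitz_add:
  "f \<in> carlitz_hurwitz \<Longrightarrow> g \<in> carlitz_hurwitz \<Longrightarrow> f + g \<in> carlitz_hurwitz"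
  by (auto simp: carlitz_hurwitz_def distrib_left intro: add_mem)

text \<open>A single term of a Cauchy product: \<open>Pi(i) Pi(j)\<close> divides
  \<open>Pi(i + j)\<close>.\<close>

lemma carlitz_hurwitz_mult_aux:
  assumes "i + j = n" and "to_fract (carlitz_factorial i) * x \<in> R" "to_fract (carlitz_factorial j) * y \<in> R"
  shows "to_fract (carlitz_factorial n) * (x * y) \<in> R"
proof -
  obtain c where "carlitz_factorial n = (carlitz_factorial i * carlitz_factorial j) * (c :: 'a poly)"
    using carlitz_factorial_mult_dvd[of i j, where 'a='a] assms(1) by blast
  hence "to_fract (carlitz_factorial n) * (x * y) =
      to_fract c * ((to_fract (carlitz_factorial i) * x) * (to_fract (carlitz_factorial j) * y))"
    by (simp only: to_fract_mult mult_ac)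
  also have "\<dots> \<in> R" by (rule mult_mem[OF to_fract_mem mult_mem[OF assms(2,3)]])
  finally show ?thesis .
qed

lemma carlitz_hurwitz_mult:
  assumes "f \<in> carlitz_hurwitz" "g \<in> carlitz_hurwitz"
  shows "f * g \<in> carlitz_hurwitz"
  unfolding carlitz_hurwitz_def
proof safe
  fix n
  show "to_fract (carlitz_factorial n) * fps_nth (f * g) n \<in> R"
    unfolding fps_mult_nth sum_distrib_left using assms
    by (intro sum_mem carlitz_hurwitz_mult_aux) (auto intro: carlitz_hurwitz_D)
qed

lemma carlitz_hurwitz_const: "fps_const (to_fract c) \<in> carlitz_hurwitz"
  using to_fract_mem[of 0] to_fract_mem[of c] by (simp add: carlitz_hurwitz_def)

lemma carlitz_hurwitz_power: "f \<in> carlitz_hurwitz \<Longrightarrow> f ^ n \<in> carlitz_hurwitz"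
  using carlitz_hurwitz_const[of 1] by (induction n) (auto intro: carlitz_hurwitz_mult)

lemma carlitz_exp_mem_carlitz_hurwitz: "carlitz_exp \<in> carlitz_hurwitz"
  unfolding carlitz_hurwitz_def
proof safe
  fix n
  show "to_fract (carlitz_factorial n) * fps_nth carlitz_exp n \<in> R"
  proof (cases "n \<in> range (\<lambda>i. CARD('a) ^ i)")
    case True
    then obtain i where "n = CARD('a) ^ i" by blast
    thus ?thesis using to_fract_mem[of 1]
      by (simp add: carlitz_exp_nth carlitz_factorial_card_power carlitz_D_nonzero)
  next
    case False
    thus ?thesis using to_fract_mem[of 0] by (simp add: carlitz_exp_nth_eq_0)
  qed
qed

text \<open>In the coefficient \<open>(n + 1) f_(n+1)\<close>, either \<open>q\<close> divides
  \<open>n + 1\<close> and the integer factor vanishes in characteristic \<open>p\<close>, or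
  \<open>Pi(n + 1) = Pi(n)\<close>.\<close>

lemma carlitz_hurwitz_deriv:
  assumes "f \<in> carlitz_hurwitz"
  shows "fps_deriv f \<in> carlitz_hurwitz"
  unfolding carlitz_hurwitz_def
proof safe
  fix n
  show "to_fract (carlitz_factorial n) * fps_nth (fps_deriv f) n \<in> R"
  proof (cases "CARD('a) dvd Suc n")
    case True
    hence "CHAR('a poly fract) dvd Suc n" using CHAR_dvd_card[where 'a='a] dvd_trans by auto
    hence "of_nat (Suc n) = (0 :: 'a poly fract)" unfolding of_nat_eq_0_iff_char_dvd .
    thus ?thesis using to_fract_mem[of 0] by (simp del: of_nat_Suc)
  next
    case False
    have "of_nat k * x \<in> R" if "x \<in> R" for k x
      using that to_fract_mem[of 0] 
      by (induction k) (auto simp: distrib_right intro: add_mem)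
    hence "of_nat (Suc n) * (to_fract (carlitz_factorial (Suc n)) * fps_nth f (Suc n)) \<in> R"
      using carlitz_hurwitz_D[OF assms] by blast
    thus ?thesis using carlitz_factorial_Suc_eq[OF False] by (simp add: mult_ac del: of_nat_Suc)
  qed
qed

text \<open>Solving \<open>u g = h\<close> for the coefficients of \<open>g\<close> one after
  another divides only by the constant term of \<open>u\<close>.\<close>

lemma carlitz_hurwitz_cancel:
  assumes "u \<in> carlitz_hurwitz" "u * g \<in> carlitz_hurwitz" 
    and "inverse (fps_nth u 0) \<in> R" "fps_nth u 0 \<noteq> 0"
  shows "g \<in> carlitz_hurwitz"
proof -
  have "to_fract (carlitz_factorial n) * fps_nth g n \<in> R" for n
  proof (induction n rule: less_induct)
    case (less n)
    let ?s = "\<Sum>i\<in>{1..n}. to_fract (carlitz_factorial n) * (fps_nth u i * fps_nth g (n - i))"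
    have "to_fract (carlitz_factorial n) * fps_nth (u * g) n =
        to_fract (carlitz_factorial n) * (fps_nth u 0 * fps_nth g n) + ?s"
      by (simp add: fps_mult_nth sum_distrib_left distrib_left sum.atLeast_Suc_atMost)
    hence "to_fract (carlitz_factorial n) * fps_nth g n =
        inverse (fps_nth u 0) * (to_fract (carlitz_factorial n) * fps_nth (u * g) n - ?s)"
      using assms(4) by (simp add: field_simps)
    moreover have "?s \<in> R"
    proof (intro sum_mem)
      fix i assume "i \<in> {1..n}"
      thus "to_fract (carlitz_factorial n) * (fps_nth u i * fps_nth g (n - i)) \<in> R"
        using carlitz_hurwitz_D[OF assms(1)] less.IH
        by (intro carlitz_hurwitz_mult_aux[of i "n - i"]) auto
    qed
    ultimately show ?case
      using assms by (auto intro!: mult_mem diff_mem carlitz_hurwitz_D)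
  qed
  thus ?thesis by (simp add: carlitz_hurwitz_def)
qed

text \<open>By induction along Horner's scheme, \<open>e(aX) / e(X)\<close> is built from
  \<open>e\<close> and constants of \<open>A\<close> by sums and products.\<close>

lemma fps_scale_carlitz_exp_factor:
  "\<exists>u\<in>carlitz_hurwitz. fps_scale (to_fract a) carlitz_exp = carlitz_exp * u"
proof (induction a)
  case 0
  have "fps_scale 0 carlitz_exp = (0 :: 'a poly fract fps)"
    by (rule fps_ext) (auto simp: power_0_left)
  thus ?case using carlitz_hurwitz_const[of 0] by (intro bexI[of _ 0]) auto
next
  case (pCons x a)
  let ?e = "carlitz_exp :: 'a poly fract fps"
  from pCons.IH obtain u where u: "u \<in> carlitz_hurwitz" "fps_scale (to_fract a) ?e = ?e * u" by blast
  \<comment> \<open>The Horner step divided by \<open>e\<close>: the term \<open>(e u) ^ q\<close>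
    leaves \<open>e ^ (q - 1) u ^ q\<close>.\<close>
  define v where "v = fps_const (to_fract [:x:]) + fps_const (to_fract theta) * u + ?e ^ (CARD('a) - 1) * u ^ CARD('a)"
  have "v \<in> carlitz_hurwitz" unfolding v_def
    by (intro carlitz_hurwitz_add carlitz_hurwitz_mult carlitz_hurwitz_const carlitz_hurwitz_power
          carlitz_exp_mem_carlitz_hurwitz u(1))
  moreover have "fps_scale (to_fract (pCons x a)) ?e = ?e * v"
  proof -
    have "?e ^ CARD('a) = ?e * ?e ^ (CARD('a) - 1)" by (simp flip: power_Suc)
    thus ?thesis
      unfolding fps_scale_carlitz_exp_pCons u(2) v_def by (simp add: power_mult_distrib algebra_simps)
  qed
  ultimately show ?case by blast
qed

text \<open>The quotient \<open>(b(aX) - b) / X\<close> equals \<open>u' / u\<close>, which is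
  integral in the Hurwitz sense because the constant term \<open>a\<close> of \<open>u\<close> is a
  unit of \<open>R\<close>.\<close>

lemma power_minus_1_mult_carlitz_mem:
  assumes "inverse (to_fract a) \<in> R" "a \<noteq> 0" "n > 0"
  shows "(to_fract a ^ n - 1) * (to_fract (carlitz_factorial (n - 1)) * fps_nth (fps_X / carlitz_exp) n) \<in> R"
proof -
  let ?e = "carlitz_exp :: 'a poly fract fps"
  define b where "b = fps_X / ?e"
  have "b = Abs_fps (\<lambda>n. bernoulli_carlitz n / to_fract (carlitz_factorial n))"
    by (rule fps_ext) (simp add: b_def bernoulli_carlitz_def carlitz_factorial_nonzero)
  hence be: "b * ?e = fps_X" using bernoulli_carlitz_generating_function[where 'a='a] by simp
  obtain u where u: "u \<in> carlitz_hurwitz" "fps_scale (to_fract a) ?e = ?e * u"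
    using fps_scale_carlitz_exp_factor by blast
  have "fps_nth (fps_scale (to_fract a) ?e) 1 = fps_nth (?e * u) 1" by (simp add: u(2))
  hence u0: "fps_nth u 0 = to_fract a" by (simp add: fps_mult_nth sum.atLeast_Suc_atMost)
  \<comment> \<open>Only the linear term survives: the other exponents \<open>q ^ i\<close> are
    divisible by \<open>p\<close>.\<close>
  have deriv: "fps_deriv (fps_scale (to_fract c) ?e) = fps_const (to_fract c)" for c
  proof (rule fps_ext)
    fix k
    show "fps_nth (fps_deriv (fps_scale (to_fract c) ?e)) k = fps_nth (fps_const (to_fract c)) k"
    proof (cases "Suc k \<in> range (\<lambda>i. CARD('a) ^ i)")
      case True
      then obtain i where i: "Suc k = CARD('a) ^ i" by blast
      show ?thesis
      proof (cases i)
        case 0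
        thus ?thesis using i by simp
      next
        case (Suc j)
        hence "CHAR('a poly fract) dvd Suc k"
          unfolding i using CHAR_dvd_card[where 'a='a] by simp
        hence "of_nat (Suc k) = (0 :: 'a poly fract)" unfolding of_nat_eq_0_iff_char_dvd .
        moreover have "k \<noteq> 0" using i Suc card_field_ge_2[where 'a='a] by (cases "k = 0") auto
        ultimately show ?thesis by (simp del: of_nat_Suc)
      qed
    next
      case False
      moreover from this have "k \<noteq> 0" by (metis One_nat_def power_0 rangeI)
      ultimately show ?thesis by (simp add: carlitz_exp_nth_eq_0)
    qed
  qed
  have "fps_scale (to_fract 1) ?e = ?e" by (rule fps_ext) simp
  hence e': "fps_deriv ?e = 1" using deriv[of 1] by simp
  \<comment> \<open>The product rule for \<open>e(aX) = e u\<close>, with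
    \<open>e' = 1\<close>.\<close>
  have dlog: "u + ?e * fps_deriv u = fps_const (to_fract a)"
    using deriv[of a] unfolding u(2) by (simp add: e' add.commute)
  \<comment> \<open>Substituting \<open>aX\<close> in \<open>b e = X\<close> gives
    \<open>aX\<close>; replacing \<open>a\<close> by \<open>u + e u'\<close> and \<open>X\<close> by
    \<open>b e\<close> then exposes a common factor \<open>e\<close>.\<close>
  have "fps_scale (to_fract a) b * (?e * u) = fps_scale (to_fract a) (b * ?e)"
    by (simp add: fps_scale_mult u(2))
  also have "\<dots> = fps_const (to_fract a) * fps_X"
    unfolding be by (rule fps_ext) (auto simp: fps_X_def)
  also have "\<dots> = u * (b * ?e) + ?e * fps_deriv u * fps_X"
    unfolding be dlog[symmetric] by (rule distrib_right)
  finally have "?e * (u * (fps_scale (to_fract a) b - b)) = ?e * (fps_X * fps_deriv u)"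
    by (simp add: algebra_simps)
  moreover have "?e \<noteq> 0" using carlitz_exp_nth_1 by (metis fps_zero_nth zero_neq_one)
  ultimately have *: "u * (fps_scale (to_fract a) b - b) = fps_X * fps_deriv u" by simp
  \<comment> \<open>The constant terms cancel, so \<open>X\<close> can be divided out. This moves
    coefficient \<open>n\<close> to \<open>n - 1\<close> and brings in \<open>Pi(n - 1)\<close>
    instead of \<open>Pi(n)\<close>.\<close>
  define g where "g = fps_shift 1 (fps_scale (to_fract a) b - b)"
  have "fps_scale (to_fract a) b - b = fps_X * g"
    by (rule fps_ext) (simp add: g_def fps_X_mult_nth)
  with * have "fps_X * (u * g) = fps_X * fps_deriv u" by (simp add: mult_ac)
  hence "u * g = fps_deriv u" by simp
  hence "g \<in> carlitz_hurwitz"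
    using u(1) u0 assms carlitz_hurwitz_deriv by (intro carlitz_hurwitz_cancel[of u g]) auto
  hence "to_fract (carlitz_factorial (n - 1)) * fps_nth g (n - 1) \<in> R" by (rule carlitz_hurwitz_D)
  moreover have "fps_nth g (n - 1) = (to_fract a ^ n - 1) * fps_nth b n"
    using assms(3) by (simp add: g_def algebra_simps)
  ultimately show ?thesis by (simp add: b_def mult_ac)
qed

end

section \<open>Localization at a prime, and recovering \<open>F[theta]\<close> from all
  localizations\<close>

definition fract_localization :: "'a::idom \<Rightarrow> 'a fract set" where
  "fract_localization P = {x. \<exists>w. \<not> P dvd w \<and> to_fract w * x \<in> range to_fract}"

lemma fract_overring_localization:
  fixes P :: "'a::{field,finite} poly"
  assumes "prime_elem P"
  shows "fract_overring (fract_localization P)"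
proof
  show "to_fract x \<in> fract_localization P" for x
    using assms by (auto simp: fract_localization_def prime_elem_def intro!: exI[of _ 1])
next
  fix x y assume "x \<in> fract_localization P" "y \<in> fract_localization P"
  then obtain v w s t where *: "\<not> P dvd v" "to_fract v * x = to_fract s"
      "\<not> P dvd w" "to_fract w * y = to_fract t"
    by (auto simp: fract_localization_def)
  have vw: "\<not> P dvd v * w" using * assms by (simp add: prime_elem_dvd_mult_iff)
  have "to_fract (v * w) * (x + y) = to_fract w * (to_fract v * x) + to_fract v * (to_fract w * y)"
    by (simp add: algebra_simps)
  also have "\<dots> = to_fract (w * s + v * t)" by (simp add: *)
  finally show "x + y \<in> fract_localization P" using vw unfolding fract_localization_def by blast
  have "to_fract (v * w) * (x * y) = (to_fract v * x) * (to_fract w * y)"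
    by (simp add: mult_ac)
  also have "\<dots> = to_fract (s * t)" by (simp add: *)
  finally show "x * y \<in> fract_localization P" using vw unfolding fract_localization_def by blast
qed

text \<open>Elements of the base ring not divisible by \<open>P\<close> become units; the two
  denominators multiply to one that \<open>P\<close> still does not divide.\<close>

lemma fract_localization_cancel:
  fixes P :: "'a::idom"
  assumes "prime_elem P" "\<not> P dvd w" "to_fract w * x \<in> fract_localization P"
  shows "x \<in> fract_localization P"
proof -
  obtain v where "\<not> P dvd v" "to_fract v * (to_fract w * x) \<in> range to_fract"
    using assms(3) by (auto simp: fract_localization_def)
  thus ?thesis using assms(1,2) unfolding fract_localization_def
    by (auto intro!: exI[of _ "v * w"] simp: prime_elem_dvd_mult_iff mult.assoc)
qed

text \<open>A nonconstant divisor of least degree is irreducible, hence prime.\<close>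

lemma field_poly_ex_prime_elem_dvd:
  fixes g :: "'a::field poly"
  assumes "degree g > 0"
  shows "\<exists>P. prime_elem P \<and> P dvd g"
proof -
  have g: "g \<noteq> 0" using assms by auto
  obtain P where P: "P dvd g" "degree P > 0"
      and min: "\<And>h. h dvd g \<Longrightarrow> degree h > 0 \<Longrightarrow> degree P \<le> degree h"
    using ex_has_least_nat[of "\<lambda>h. h dvd g \<and> degree h > 0" g degree] assms by auto
  have "P \<noteq> 0" using P(2) by auto
  have "irreducible P"
  proof (rule irreducibleI)
    fix a b assume ab: "P = a * b"
    have nz: "a \<noteq> 0" "b \<noteq> 0" using P(2) ab by auto
    have "a dvd g" "b dvd g" using P(1) ab dvd_mult_left dvd_mult_right by auto
    hence "degree a = 0 \<or> degree P \<le> degree a" "degree b = 0 \<or> degree P \<le> degree b"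
      using min by auto
    moreover have "degree P = degree a + degree b" unfolding ab using nz by (rule degree_mult_eq)
    ultimately have "degree a = 0 \<or> degree b = 0" by auto
    thus "is_unit a \<or> is_unit b" using nz by (simp add: is_unit_iff_degree)
  qed (use P \<open>P \<noteq> 0\<close> in \<open>simp_all add: is_unit_iff_degree\<close>)
  thus ?thesis using P(1) field_poly_irreducible_imp_prime by blast
qed

text \<open>The denominators of \<open>x\<close> form an ideal \<open>J\<close> with a generator
  \<open>g\<close>. A prime dividing \<open>g\<close> would divide every denominator, against
  integrality at that prime; so \<open>g\<close> is a unit.\<close>

lemma range_to_fract_if_localizations:
  fixes x :: "'a::field poly fract"
  assumes "\<And>P :: 'a poly. prime_elem P \<Longrightarrow> x \<in> fract_localization P"
  shows "x \<in> range to_fract"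
proof -
  define J where "J = {s. to_fract s * x \<in> range to_fract}"
  obtain c d where "x = to_fract c / to_fract d" "d \<noteq> 0"
    by (metis Fract_conv_to_fract Fract_cases)
  hence "to_fract d * x = to_fract c" by simp
  hence d: "d \<in> J" unfolding J_def by blast
  have "\<exists>g. g \<in> J \<and> g \<noteq> 0 \<and> (\<forall>h. h \<in> J \<and> h \<noteq> 0 \<longrightarrow> degree g \<le> degree h)"
    using ex_has_least_nat[of "\<lambda>g. g \<in> J \<and> g \<noteq> 0" d degree] d \<open>d \<noteq> 0\<close> by auto
  then obtain g where g: "g \<in> J" "g \<noteq> 0" and
      min: "\<And>h. h \<in> J \<Longrightarrow> h \<noteq> 0 \<Longrightarrow> degree g \<le> degree h" by blast
  \<comment> \<open>The remainder of \<open>s\<close> by \<open>g\<close> is again a denominator,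
    and \<open>g\<close> has least degree.\<close>
  have dvd: "g dvd s" if s: "s \<in> J" for s
  proof (rule ccontr)
    assume "\<not> g dvd s"
    hence nz: "s mod g \<noteq> 0" by (simp add: dvd_eq_mod_eq_0)
    obtain t where t: "to_fract s * x = to_fract t" using s by (auto simp: J_def)
    obtain v where v: "to_fract g * x = to_fract v" using g(1) by (auto simp: J_def)
    have "to_fract (s mod g) * x = to_fract s * x - to_fract (s div g) * (to_fract g * x)"
      by (simp add: minus_div_mult_eq_mod[symmetric] algebra_simps)
    also have "\<dots> = to_fract (t - s div g * v)" by (simp add: t v)
    finally have "s mod g \<in> J" unfolding J_def by blast
    with nz min have "degree g \<le> degree (s mod g)" by blast
    thus False using degree_mod_less'[OF g(2) nz] by simp
  qed
  have "degree g = 0"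
  proof (rule ccontr)
    assume "degree g \<noteq> 0"
    then obtain P where P: "prime_elem P" "P dvd g" using field_poly_ex_prime_elem_dvd by blast
    from assms[OF P(1)] obtain w where "\<not> P dvd w" "w \<in> J"
      by (auto simp: fract_localization_def J_def)
    with dvd P(2) show False using dvd_trans by blast
  qed
  hence "g dvd 1" using g(2) by (simp add: is_unit_iff_degree)
  then obtain h where h: "g * h = 1" by (metis dvdE)
  obtain v where v: "to_fract g * x = to_fract v" using g(1) by (auto simp: J_def)
  have "x = to_fract (g * h) * x" by (simp add: h)
  also have "\<dots> = to_fract h * (to_fract g * x)" by (simp add: mult_ac)
  also have "\<dots> = to_fract (h * v)" by (simp add: v)
  finally show ?thesis by blast
qed

section \<open>The power of \<open>P\<close> in \<open>(1 + P) ^ n - 1\<close>, and integrality at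
  every prime\<close>

lemma one_plus_power_minus_1_factor:
  fixes P :: "'a::{field,finite} poly"
  assumes "prime_elem P" "\<not> CHAR('a) dvd k"
  shows "\<exists>u. \<not> P dvd u \<and> (1 + P) ^ (CHAR('a) ^ c * k) - 1 = (P * u) ^ (CHAR('a) ^ c)"
proof (intro exI[of _ "\<Sum>i<k. (1 + P) ^ i"] conjI)
  let ?u = "\<Sum>i<k. (1 + P) ^ i"
  \<comment> \<open>Each summand is 1 modulo \<open>P\<close>, so the geometric sum is
    \<open>k\<close> modulo \<open>P\<close>, a nonzero constant.\<close>
  have "P dvd (1 + P) ^ i - 1" for i
    using power_diff_1_eq[of "1 + P" i] by simp
  hence "P dvd (\<Sum>i<k. (1 + P) ^ i - 1)" by (intro dvd_sum)
  hence "P dvd ?u - of_nat k" by (simp add: sum_subtractf)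
  moreover have "\<not> P dvd of_nat k"
  proof
    assume "P dvd of_nat k"
    moreover have "of_nat k \<noteq> (0 :: 'a)" using assms(2) by (simp add: of_nat_eq_0_iff_char_dvd)
    hence "is_unit (of_nat k :: 'a poly)" by (simp add: of_nat_poly is_unit_triv)
    ultimately have "is_unit P" by (rule dvd_unit_imp_unit)
    with assms(1) show False by (simp add: prime_elem_def)
  qed
  ultimately show "\<not> P dvd ?u" by (metis dvd_diff_commute dvd_diffD dvd_add_right_iff diff_add_cancel)
  have frob: "(x - 1) ^ (CHAR('a) ^ c) = x ^ (CHAR('a) ^ c) - 1" for x :: "'a poly"
    using freshmans_dream'[where 'a="'a poly", of "CHAR('a) ^ c" c "x - 1" 1]
    by (simp add: CHAR_prime_finite_field)
  \<comment> \<open>The geometric sum gives \<open>P u = (1 + P) ^ k - 1\<close>; Frobenius carries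
    the \<open>p ^ c\<close>-th power inside the difference.\<close>
  have "(P * ?u) ^ (CHAR('a) ^ c) = ((1 + P) ^ k - 1) ^ (CHAR('a) ^ c)"
    using power_diff_1_eq[of "1 + P" k] by simp
  thus "(1 + P) ^ (CHAR('a) ^ c * k) - 1 = (P * ?u) ^ (CHAR('a) ^ c)"
    by (simp add: frob mult.commute flip: power_mult)
qed

theorem mainTheorem6:
  fixes n m c m0 l :: nat and eps :: "'a::{field,finite} poly"
  assumes "n > 0" and "(CARD('a) - 1) dvd n"
    and "m = n div (CARD('a) - 1)"
    and "m = CHAR('a) ^ c * m0" and "m0 > 0" and "coprime m0 CHAR('a)"
    and "l = Lcm {r. r \<ge> 1 \<and> (CARD('a) ^ r - 1) dvd n}"
    and "eps = (monom 1 (CARD('a) ^ l) - monom 1 1) ^ (CHAR('a) ^ c)"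
  shows "to_fract (pcompose eps theta) * bernoulli_carlitz n
           * (to_fract (carlitz_factorial (n - 1)) / to_fract (carlitz_factorial n))
         \<in> range (to_fract :: 'a poly \<Rightarrow> 'a poly fract)"
proof -
  \<comment> \<open>What remains of the claim once the \<open>Pi(n)\<close> inside
    \<open>BC_n\<close> cancels the denominator.\<close>
  define \<beta> :: "'a poly fract" where
    "\<beta> = to_fract (carlitz_factorial (n - 1)) * fps_nth (fps_X / carlitz_exp) n"
  \<comment> \<open>As \<open>p\<close> divides \<open>q\<close>, it does not divide
    \<open>q - 1\<close>; so \<open>p ^ c\<close>, the exact power of \<open>p\<close> in
    \<open>m\<close>, is also the exact power in \<open>n\<close>.\<close>
  define k where "k = (CARD('a) - 1) * m0"
  have n: "n = CHAR('a) ^ c * k"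
    using assms(2-4) by (metis dvd_mult_div_cancel k_def mult.left_commute)
  have p: "prime CHAR('a)" by (rule CHAR_prime_finite_field)
  have "\<not> CHAR('a) dvd CARD('a) - 1"
  proof
    assume "CHAR('a) dvd CARD('a) - 1"
    moreover have "CARD('a) - (CARD('a) - 1) = 1" using card_field_ge_2[where 'a='a] by simp
    ultimately have "CHAR('a) dvd 1" using CHAR_dvd_card[where 'a='a] by (metis dvd_diff_nat)
    thus False using p not_prime_unit by blast
  qed
  moreover have "\<not> CHAR('a) dvd m0" using assms(6) p by (metis coprime_absorb_right not_prime_unit)
  ultimately have k: "\<not> CHAR('a) dvd k" using p by (simp add: k_def prime_dvd_mult_iff)
  have eps: "pcompose eps theta = (theta ^ (CARD('a) ^ l) - theta) ^ (CHAR('a) ^ c)"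
    unfolding assms(8) by (simp add: monom_altdef)
  have "to_fract (pcompose eps theta) * \<beta> \<in> fract_localization P" if P: "prime_elem P" for P
  proof -
    interpret fract_overring "fract_localization P" using P by (rule fract_overring_localization)
    have local: "to_fract (a ^ n - 1) * \<beta> \<in> fract_localization P" if "\<not> P dvd a" for a
    proof -
      have "a \<noteq> 0" using that by auto
      hence "inverse (to_fract a) \<in> fract_localization P"
        using that fract_localization_cancel[OF P that, of "inverse (to_fract a)"] to_fract_mem[of 1]
        by simp
      thus ?thesis
        using power_minus_1_mult_carlitz_mem[OF _ \<open>a \<noteq> 0\<close> \<open>n > 0\<close>] by (simp add: \<beta>_def)
    qed
    show ?thesis
    proof (cases "(CARD('a) ^ degree P - 1) dvd n")
      case False
      then obtain a where "\<not> P dvd a" "\<not> P dvd a ^ n - 1"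
        using ex_poly_power_not_cong_1[OF P] by blast
      hence "\<beta> \<in> fract_localization P" using local fract_localization_cancel[OF P] by blast
      thus ?thesis by (intro mult_mem to_fract_mem)
    next
      case True
      \<comment> \<open>\<open>degree P\<close> is one of the numbers \<open>r\<close> in the least
        common multiple.\<close>
      have "degree P dvd l"
        unfolding assms(7) using True prime_elem_poly_degree_pos[OF P] by (intro dvd_Lcm) auto
      then obtain s where s: "theta ^ (CARD('a) ^ l) - theta = P * s"
        using prime_elem_dvd_theta_power[OF P] by (metis dvdE)
      obtain u where u: "\<not> P dvd u" "(1 + P) ^ n - 1 = (P * u) ^ (CHAR('a) ^ c)"
        using one_plus_power_minus_1_factor[OF P k] n by metis
      have "\<not> P dvd 1 + P" using P by (simp add: prime_elem_def)
      \<comment> \<open>Here \<open>eps_n(theta) = (P s) ^ (p ^ c)\<close> and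
        \<open>(1 + P) ^ n - 1 = (P u) ^ (p ^ c)\<close> share the power of \<open>P\<close>.
        Multiplying by \<open>s ^ (p ^ c)\<close> turns the second into the first times
        \<open>u ^ (p ^ c)\<close>, a unit at \<open>P\<close>.\<close>
      from local[OF this] have "to_fract (s ^ (CHAR('a) ^ c)) * (to_fract ((P * u) ^ (CHAR('a) ^ c)) * \<beta>)
          \<in> fract_localization P" unfolding u(2) by (rule mult_mem[OF to_fract_mem])
      also have "to_fract (s ^ (CHAR('a) ^ c)) * (to_fract ((P * u) ^ (CHAR('a) ^ c)) * \<beta>) =
          to_fract (u ^ (CHAR('a) ^ c)) * (to_fract (pcompose eps theta) * \<beta>)"
        unfolding eps s by (simp add: power_mult_distrib mult_ac)
      finally show ?thesis
        using fract_localization_cancel[OF P] u(1) P prime_elem_dvd_power by blast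
    qed
  qed
  hence "to_fract (pcompose eps theta) * \<beta> \<in> range to_fract" by (rule range_to_fract_if_localizations)
  thus ?thesis by (simp add: \<beta>_def bernoulli_carlitz_def carlitz_factorial_nonzero mult_ac)
qed

end
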